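(* Let $N\ge 2$ and let $(E_N)$, sums, equivalence and irreducibility be as in the context. Then, up to cyclic permutation: (i) the irreducible solutions of $(E_2)$ are $(1,1,1)$ and $(0,0,0,0)$; (ii) the irreducible solutions of $(E_3)$ are $(1,1,1)$, $(-1,-1,-1)$ and $(0,0,0,0)$; (iii) the irreducible solutions of $(E_4)$ are $(1,1,1)$, $(-1,-1,-1)$, $(0,0,0,0)$, $(0,2,0,2)$, $(2,0,2,0)$ and $(2,2,2,2)$; (iv) the irreducible solutions of $(E_5)$ are $(1,1,1)$, $(-1,-1,-1)$, $(0,0,0,0)$, $(0,2,0,3)$, $(2,2,2,2,2)$, $(3,3,3,3,3)$, $(3,2,2,3,2,2)$, $(2,3,3,2,3,3)$, $(2,3,2,3,2,3)$; (v) the irreducible solutions of $(E_6)$ are $(1,1,1)$, $(-1,-1,-1)$, $(0,0,0,0)$, $(2,4,2,4)$, $(2,3,4,3)$, $(0,2,0,4)$, $(0,3,0,3)$, $(2,2,2,2,2,2)$, $(3,3,3,3,3,3)$, $(4,4,4,4,4,4)$. (Entries are residues in $\mathbb{Z}/N\mathbb{Z}$; "up to cyclic permutation" means the irreducible solutions are exactly the cyclic permutations of the listed tuples.)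
   Context: Let $N\ge 2$ be an integer. For $a_1,\dots,a_n\in\mathbb{Z}/N\mathbb{Z}$ set $M_n(a_1,\dots,a_n)=\begin{pmatrix}a_n&-1\\1&0\end{pmatrix}\begin{pmatrix}a_{n-1}&-1\\1&0\end{pmatrix}\cdots\begin{pmatrix}a_1&-1\\1&0\end{pmatrix}$. An $n$-tuple $(a_1,\dots,a_n)\in(\mathbb{Z}/N\mathbb{Z})^n$ is a solution of $(E_N)$ (of size $n$) if $M_n(a_1,\dots,a_n)=\pm \mathrm{Id}$ over $\mathbb{Z}/N\mathbb{Z}$. The sum of $(a_1,\dots,a_n)$ and $(b_1,\dots,b_m)$ is $(a_1,\dots,a_n)\oplus(b_1,\dots,b_m)=(a_1+b_m,a_2,\dots,a_{n-1},a_n+b_1,b_2,\dots,b_{m-1})\in(\mathbb{Z}/N\mathbb{Z})^{n+m-2}$. Two $n$-tuples are equivalent ($\sim$) if one is obtained by a cyclic permutation of the other or of the other read in reverse order. A solution $(c_1,\dots,c_n)$ of $(E_N)$ with $n\ge3$ is reducible if there exist solutions $(a_1,\dots,a_m)$ and $(b_1,\dots,b_l)$ of $(E_N)$ with $m\ge3$, $l\ge3$ and $(c_1,\dots,c_n)\sim(a_1,\dots,a_m)\oplus(b_1,\dots,b_l)$; a solution of size $n\ge 3$ is irreducible if it is not reducible (so $(0,0)$ is not irreducible). *)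

theory Defs
  imports "HOL-Analysis.Analysis"
begin

text \<open>
  The ring of integers modulo \<open>N\<close> is the numeral type \<open>N\<close> of
  \<^theory>\<open>HOL-Library.Numeral_Type\<close>: it has \<open>N\<close> elements, and for \<open>N \<ge> 2\<close> its ring operations
  are those of the integers modulo \<open>N\<close>.  The definitions below make sense over any commutative
  ring; \<open>(E_N)\<close> is the instance in which the type of the entries is \<open>N\<close>.
  The tuple \<open>(a_1, \<dots>, a_n)\<close> is the list \<open>[a_1, \<dots>, a_n]\<close>.
\<close>

definition elem_mat :: "'a::comm_ring_1 \<Rightarrow> 'a ^ 2 ^ 2" where
  "elem_mat a = vector [vector [a, - 1], vector [1, 0]]"

text \<open>The factor of the first entry stands rightmost:
  \<open>mat_M [a_1, \<dots>, a_n] = elem_mat a_n ** \<dots> ** elem_mat a_1\<close>.\<close>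

primrec mat_M :: "'a::comm_ring_1 list \<Rightarrow> 'a ^ 2 ^ 2" where
  "mat_M [] = mat 1"
| "mat_M (a # as) = mat_M as ** elem_mat a"

definition solution :: "'a::comm_ring_1 list \<Rightarrow> bool" where
  "solution as \<longleftrightarrow> mat_M as = mat 1 \<or> mat_M as = - mat 1"

text \<open>\<open>(a_1 + b_m, a_2, \<dots>, a_{n-1}, a_n + b_1, b_2, \<dots>, b_{m-1})\<close>; only meaningful if both
  lists have at least two entries.\<close>

definition tuple_sum :: "'a::comm_ring_1 list \<Rightarrow> 'a list \<Rightarrow> 'a list" where
  "tuple_sum as bs =
     [hd as + last bs] @ butlast (tl as) @ [last as + hd bs] @ butlast (tl bs)"

definition cyclic_perm :: "'a list \<Rightarrow> 'a list \<Rightarrow> bool" where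
  "cyclic_perm as bs \<longleftrightarrow> (\<exists>k. as = rotate k bs)"

definition tuple_equiv :: "'a list \<Rightarrow> 'a list \<Rightarrow> bool" where
  "tuple_equiv as bs \<longleftrightarrow> cyclic_perm as bs \<or> cyclic_perm as (rev bs)"

definition reducible :: "'a::comm_ring_1 list \<Rightarrow> bool" where
  "reducible cs \<longleftrightarrow> solution cs \<and> length cs \<ge> 3 \<and>
     (\<exists>as bs. solution as \<and> solution bs \<and> length as \<ge> 3 \<and> length bs \<ge> 3 \<and>
        tuple_equiv cs (tuple_sum as bs))"

definition irreducible_solution :: "'a::comm_ring_1 list \<Rightarrow> bool" where
  "irreducible_solution cs \<longleftrightarrow> solution cs \<and> length cs \<ge> 3 \<and> \<not> reducible cs"

definition cyclic_closure :: "'a list set \<Rightarrow> 'a list set" where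
  "cyclic_closure S = {cs. \<exists>as\<in>S. cyclic_perm cs as}"

end

theory Submission
  imports Defs "HOL-Library.Sublist"
begin

text \<open>
  The upper left entry of \<open>mat_M w\<close> is the continuant of \<open>w\<close>, and \<open>x, w, y\<close> is a solution for
  suitable \<open>x\<close> and \<open>y\<close> exactly if the continuant of \<open>w\<close> is \<open>1\<close> or \<open>-1\<close>; then \<open>x\<close> and \<open>y\<close> are
  determined by \<open>w\<close>.  Since a summand of a sum is visible as a block of consecutive entries, a
  solution of size \<open>n\<close> is irreducible if and only if no cyclic block of length between \<open>1\<close> and
  \<open>n - 3\<close> has continuant \<open>1\<close> or \<open>-1\<close>.  Modulo \<open>N \<le> 6\<close> this condition excludes the sizes
  \<open>n \<ge> 7\<close> and leaves few candidates for the middle entries in the smaller ones.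
\<close>

subsection \<open>Continuants\<close>

lemma mat_M_append: "mat_M (as @ bs) = mat_M bs ** mat_M as"
  by (induction as) (simp_all add: matrix_mul_assoc)

lemma mat_M_Cons_nth:
  "mat_M (a # as) $ i $ 1 = mat_M as $ i $ 1 * a + mat_M as $ i $ 2"
  "mat_M (a # as) $ i $ 2 = - mat_M as $ i $ 1"
  by (simp_all add: matrix_matrix_mult_def sum_2 elem_mat_def)

lemma mat_M_snoc: "mat_M (as @ [a]) = elem_mat a ** mat_M as"
  by (simp add: mat_M_append)

lemma mat_M_snoc_nth:
  "mat_M (as @ [a]) $ 1 $ i = a * mat_M as $ 1 $ i - mat_M as $ 2 $ i"
  "mat_M (as @ [a]) $ 2 $ i = mat_M as $ 1 $ i"
  by (simp_all add: mat_M_snoc matrix_matrix_mult_def sum_2 elem_mat_def)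

lemma mat_M_Nil_nth:
  "mat_M [] $ 1 $ 1 = 1" "mat_M [] $ 1 $ 2 = 0" "mat_M [] $ 2 $ 1 = 0" "mat_M [] $ 2 $ 2 = 1"
  by (simp_all add: mat_def)

text \<open>Up to the choice of signs this is Euler's continuant: the determinant of the tridiagonal
  matrix with diagonal \<open>as\<close> and ones on both neighbouring diagonals.\<close>

definition continuant :: "'a::comm_ring_1 list \<Rightarrow> 'a" where
  "continuant as = mat_M as $ 1 $ 1"

lemma continuant_simps [simp]:
  "continuant [] = 1"
  "continuant [a] = a"
  "continuant (a # b # as) = a * continuant (b # as) - continuant as"
  by (simp_all add: continuant_def mat_M_Cons_nth mat_M_Nil_nth del: mat_M.simps)

text \<open>Conjugation by diag(1, -1) transposes each \<open>elem_mat a\<close>, and transposition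
  reverses products.\<close>

lemma mat_M_rev_nth:
  "mat_M (rev as) $ 1 $ 1 = mat_M as $ 1 $ 1"
  "mat_M (rev as) $ 1 $ 2 = - mat_M as $ 2 $ 1"
  "mat_M (rev as) $ 2 $ 1 = - mat_M as $ 1 $ 2"
  "mat_M (rev as) $ 2 $ 2 = mat_M as $ 2 $ 2"
  by (induction as)
    (simp_all add: mat_M_Nil_nth mat_M_Cons_nth mat_M_snoc_nth algebra_simps del: mat_M.simps)

lemma continuant_rev: "continuant (rev as) = continuant as"
  by (simp add: continuant_def mat_M_rev_nth)

lemma mat_M_det: "mat_M as $ 1 $ 1 * mat_M as $ 2 $ 2 - mat_M as $ 1 $ 2 * mat_M as $ 2 $ 1 = 1"
  by (induction as) (simp_all add: mat_M_Nil_nth mat_M_Cons_nth algebra_simps del: mat_M.simps)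

subsection \<open>Solutions\<close>

lemma solution_iff_nth:
  "solution as \<longleftrightarrow> (\<exists>p. (p = 1 \<or> p = -1) \<and> mat_M as $ 1 $ 1 = p \<and> mat_M as $ 1 $ 2 = 0
     \<and> mat_M as $ 2 $ 1 = 0 \<and> mat_M as $ 2 $ 2 = p)"
  by (auto simp: solution_def vec_eq_iff forall_2 mat_def)

lemma elem_mat_inverse:
  fixes a :: "'a::comm_ring_1"
  obtains B where "elem_mat a ** B = mat 1"
proof
  show "elem_mat a ** vector [vector [0, 1], vector [-1, a]] = mat 1"
    by (simp add: vec_eq_iff forall_2 matrix_matrix_mult_def sum_2 elem_mat_def mat_def)
qed

lemma matrix_neg_mult:
  fixes A B :: "'a::comm_ring_1 ^ 2 ^ 2"
  shows "(- A) ** B = - (A ** B)" "A ** (- B) = - (A ** B)"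
  by (simp_all add: vec_eq_iff matrix_matrix_mult_def sum_2)

text \<open>Moving the first factor to the other end conjugates the product by
  \<open>elem_mat a\<close>, and conjugation fixes \<open>mat 1\<close> and its negative.\<close>

lemma solution_rotate1:
  assumes "solution as"
  shows "solution (rotate1 as)"
proof (cases as)
  case (Cons a bs)
  obtain B where B: "elem_mat a ** B = mat 1" by (rule elem_mat_inverse)
  have "mat_M (bs @ [a]) = elem_mat a ** mat_M (a # bs) ** B"
    using B by (simp add: mat_M_append flip: matrix_mul_assoc)
  then show ?thesis
    using assms B unfolding solution_def Cons
    by (auto simp: matrix_neg_mult simp del: mat_M.simps)
qed (use assms in simp)

lemma solution_rotate: "solution as \<Longrightarrow> solution (rotate k as)"
  by (induction k) (simp_all add: solution_rotate1)

lemma rotate_inverse: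
  obtains j where "rotate j (rotate k xs) = xs"
proof
  have "rotate (length xs * k) xs = xs"
    by (rule rotate_id) simp
  \<comment> \<open>The subtraction is truncated only for the empty list, where every rotation is
    the identity.\<close>
  moreover have "xs = [] \<or> length xs * k - k + k = length xs * k"
    by (cases xs) auto
  ultimately show "rotate (length xs * k - k) (rotate k xs) = xs"
    by (auto simp: rotate_rotate)
qed

lemma solution_rotate_iff [simp]: "solution (rotate k as) \<longleftrightarrow> solution as"
  by (metis solution_rotate rotate_inverse)

text \<open>Let the matrix of \<open>u\<close> have rows p, -q and r, s. Bordering \<open>u\<close>
  by \<open>x\<close> and \<open>y\<close> gives lower right entry -p and off-diagonal entries p x -
  q and r - y p. So p must be a sign, and then x = p q and y = p r. The continuant 1 belongs to the
  matrix \<open>- mat 1\<close>.\<close>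

lemma solution_Cons_snoc_iff:
  fixes x y :: "'a::comm_ring_1"
  assumes "u \<noteq> []"
  shows "solution (x # u @ [y]) \<longleftrightarrow> (continuant u = 1 \<or> continuant u = -1)
     \<and> x = continuant u * continuant (tl u) \<and> y = continuant u * continuant (butlast u)"
proof -
  define p q r s where "p = continuant u" and "q = continuant (tl u)"
    and "r = continuant (butlast u)" and "s = mat_M u $ 2 $ 2"
  have p: "mat_M u $ 1 $ 1 = p"
    by (simp add: p_def continuant_def)
  have q: "mat_M u $ 1 $ 2 = - q"
    using assms by (cases u) (simp_all add: q_def continuant_def mat_M_Cons_nth del: mat_M.simps)
  have r: "mat_M u $ 2 $ 1 = r"
    using assms by (cases u rule: rev_cases) (simp_all add: r_def continuant_def mat_M_snoc_nth)
  have det: "p * s = 1 - q * r"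
    using mat_M_det[of u] by (simp add: p q r s_def algebra_simps)
  have "solution (x # u @ [y]) \<longleftrightarrow> (\<exists>e. (e = 1 \<or> e = -1) \<and> y * (p * x - q) - (r * x + s) = e
      \<and> r - y * p = 0 \<and> p * x - q = 0 \<and> - p = e)"
    unfolding solution_iff_nth append_Cons[symmetric] mat_M_snoc_nth mat_M_Cons_nth p q r s_def
    by (simp add: conj_ac)
  also have "\<dots> \<longleftrightarrow> (p = 1 \<or> p = -1) \<and> x = p * q \<and> y = p * r"
    (is "?L \<longleftrightarrow> ?R")
  proof
    assume ?L
    then have e: "p = 1 \<or> p = -1" and "r = y * p" "q = p * x"
      by (auto simp: minus_equation_iff[of p])
    then show ?R
      by auto
  next
    assume R: ?R
    then have "p * p = 1"
      by auto
    \<comment> \<open>Since p is its own inverse, the determinant yields s; this turns the upper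
      left entry into -p too, the sign chosen as witness.\<close>
    then have "s = p * (1 - q * r)"
      using det by (metis mult.assoc mult_1)
    with R show ?L
      by (intro exI[of _ "- p"]) auto
  qed
  finally show ?thesis
    by (simp add: p_def q_def r_def)
qed

subsection \<open>Irreducibility\<close>

lemma solution_replace:
  fixes xs :: "'a::comm_ring_1 list"
  assumes "mat_M ys = mat_M zs \<or> mat_M ys = - mat_M zs"
  shows "solution (xs @ ys @ ws) \<longleftrightarrow> solution (xs @ zs @ ws)"
proof -
  have "mat_M (xs @ ys @ ws) = mat_M (xs @ zs @ ws) \<or> mat_M (xs @ ys @ ws) = - mat_M (xs @ zs @ ws)"
    using assms by (auto simp: mat_M_append matrix_neg_mult)
  then show ?thesis
    unfolding solution_def by (metis minus_minus)
qed

text \<open>\<open>elem_mat b ** elem_mat 0 ** elem_mat a = - elem_mat (a + b)\<close>, and a sign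
  does not affect being a solution.\<close>

lemma solution_split_entry: "solution (xs @ [a + b] @ ws) \<longleftrightarrow> solution (xs @ [a, 0, b] @ ws)"
  by (rule solution_replace)
    (simp add: vec_eq_iff forall_2 mat_M_Cons_nth mat_M_Nil_nth del: mat_M.simps)

lemma solution_remove_middle:
  assumes "solution ys"
  shows "solution (xs @ ys @ ws) \<longleftrightarrow> solution (xs @ ws)"
  using solution_replace[of ys "[]" xs ws] assms by (simp add: solution_def)

text \<open>A summand can be cancelled from a sum. Splitting both glued entries at a zero and
  rotating makes the right summand a consecutive block; once it is removed, the two zeros are
  adjacent and form a solution that can be removed as well.\<close>

lemma solution_tuple_sum_left:
  fixes a a' b b' :: "'a::comm_ring_1"
  assumes "solution (b # u @ [b'])" and "solution ([a + b'] @ w @ [a' + b] @ u)"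
  shows "solution (a # w @ [a'])"
proof -
  have zero: "solution [0, 0 :: 'a]"
    by (simp add: solution_iff_nth mat_M_Cons_nth mat_M_Nil_nth del: mat_M.simps)
  have "solution ([] @ [b' + a] @ (w @ [a' + b] @ u))"
    using assms(2) by (simp add: add.commute)
  then have "solution (([b', 0, a] @ w) @ [a' + b] @ u)"
    by (subst (asm) solution_split_entry) simp
  then have "solution ([b', 0] @ (a # w @ [a', 0, b] @ u))"
    by (subst (asm) solution_split_entry) simp
  \<comment> \<open>Rotation by two moves \<open>b'\<close> behind \<open>u\<close>, which completes
    the block \<open>b # u @ [b']\<close>.\<close>
  then have "solution (rotate (length [b', 0]) ([b', 0] @ (a # w @ [a', 0, b] @ u)))"
    by (simp only: solution_rotate_iff)
  then have "solution ((a # w @ [a', 0]) @ (b # u @ [b']) @ [0])"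
    by (simp only: rotate_append) simp
  then have "solution ((a # w @ [a']) @ [0, 0] @ [])"
    by (subst (asm) solution_remove_middle[OF assms(1)]) simp
  then show ?thesis
    by (subst (asm) solution_remove_middle[OF zero]) simp
qed

text \<open>The inner entries of the right summand survive in the sum as the block \<open>u\<close>,
  so its continuant is a sign. Conversely, such a block extends to a solution by two forced ends,
  and subtracting these from the ends of \<open>v\<close> gives the left summand. The bound on
  \<open>v\<close> is the size condition on that summand.\<close>

lemma reducible_iff:
  fixes cs :: "'a::comm_ring_1 list"
  shows "reducible cs \<longleftrightarrow> solution cs \<and>
    (\<exists>k u v. rotate k cs = u @ v \<and> u \<noteq> [] \<and> length v \<ge> 3 \<and> (continuant u = 1 \<or> continuant u = -1))"
  (is "_ \<longleftrightarrow> _ \<and> ?R")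
proof (intro iffI conjI)
  assume red: "reducible cs"
  then show "solution cs" by (simp add: reducible_def)
  from red obtain as bs where sol: "solution as" "solution bs"
    and len: "length as \<ge> 3" "length bs \<ge> 3" and equiv: "tuple_equiv cs (tuple_sum as bs)"
    unfolding reducible_def by blast
  from len(2) obtain b u b' where bs: "bs = b # u @ [b']" and u: "u \<noteq> []"
    by (cases bs; cases "tl bs" rule: rev_cases) (auto simp: Suc_le_eq)
  \<comment> \<open>This is \<open>as\<close> with its two end entries changed by the gluing, hence
    of the same length.\<close>
  define v where "v = [hd as + b'] @ butlast (tl as) @ [last as + b]"
  have sum: "tuple_sum as bs = v @ u"
    by (simp add: tuple_sum_def v_def bs)
  have v: "length v \<ge> 3"
    using len(1) by (simp add: v_def)
  have cont: "continuant u = 1 \<or> continuant u = -1"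
    using sol(2) unfolding bs solution_Cons_snoc_iff[OF u] by blast
  from equiv consider k where "cs = rotate k (v @ u)" | k where "cs = rotate k (rev u @ rev v)"
    unfolding tuple_equiv_def cyclic_perm_def sum by auto
  then show ?R
  proof cases
    case 1
    then obtain j where "rotate j cs = v @ u"
      using rotate_inverse by metis
    then have "rotate (length v + j) cs = u @ v"
      by (simp add: rotate_append flip: rotate_rotate)
    then show ?R using u v cont by blast
  next
    \<comment> \<open>Reading backwards, \<open>rev u\<close> is the required block; its continuant
      is that of \<open>u\<close>.\<close>
    case 2
    then obtain j where "rotate j cs = rev u @ rev v"
      using rotate_inverse by metis
    then show ?R using u v cont by (metis continuant_rev length_rev rev_is_Nil_conv)
  qed
next
  assume "solution cs \<and> ?R"
  then obtain k u v where sol: "solution cs" and rot: "rotate k cs = u @ v" and u: "u \<noteq> []"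
    and v: "length v \<ge> 3" and cont: "continuant u = 1 \<or> continuant u = -1"
    by blast
  \<comment> \<open>The ends that \<open>solution_Cons_snoc_iff\<close> forces around
    \<open>u\<close>.\<close>
  define b b' where "b = continuant u * continuant (tl u)"
    and "b' = continuant u * continuant (butlast u)"
  have sol_bs: "solution (b # u @ [b'])"
    using cont unfolding solution_Cons_snoc_iff[OF u] by (auto simp: b_def b'_def)
  obtain c w c' where w: "v = [c] @ w @ [c']"
    using v by (cases v; cases "tl v" rule: rev_cases) auto
  \<comment> \<open>Gluing adds \<open>b'\<close> to the first entry and \<open>b\<close> to the
    last, which restores \<open>c\<close> and \<open>c'\<close>.\<close>
  define as where "as = (c - b') # w @ [c' - b]"
  have "rotate (length u) (u @ v) = v @ u"
    by (rule rotate_append)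
  then have rot': "rotate (length u + k) cs = v @ u"
    by (simp add: rot flip: rotate_rotate)
  then have "solution (v @ u)"
    using sol by (metis solution_rotate)
  then have "solution as"
    unfolding as_def by (intro solution_tuple_sum_left[OF sol_bs]) (simp add: w)
  moreover have "tuple_sum as (b # u @ [b']) = v @ u"
    using u by (simp add: tuple_sum_def as_def w)
  moreover from rot' obtain j where "cs = rotate j (v @ u)"
    using rotate_inverse by metis
  moreover have "length as \<ge> 3" "length (b # u @ [b']) \<ge> 3"
    using v u by (simp_all add: as_def w Suc_le_eq)
  moreover have "length cs \<ge> 3"
    using arg_cong[OF rot, of length] v by simp
  ultimately show "reducible cs"
    unfolding reducible_def tuple_equiv_def cyclic_perm_def using sol sol_bs by metis
qed

text \<open>Here \<open>sublists\<close> enumerates contiguous blocks. The empty block is left out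
  because its continuant is 1.\<close>

definition admissible :: "'a::comm_ring_1 list \<Rightarrow> bool" where
  "admissible w \<longleftrightarrow> (\<forall>u\<in>set (sublists w). u \<noteq> [] \<longrightarrow> continuant u \<notin> {1, -1})"

text \<open>A cyclic block with at least three entries outside it lies in the window of n - 3
  entries that starts where it starts, so checking the n windows suffices.\<close>

lemma irreducible_solution_iff:
  "irreducible_solution cs \<longleftrightarrow> solution cs \<and> 3 \<le> length cs \<and>
     (\<forall>k<length cs. admissible (take (length cs - 3) (rotate k cs)))"
  (is "_ \<longleftrightarrow> _ \<and> _ \<and> ?R")
proof (cases "3 \<le> length cs")
  case len: True
  have "(\<exists>k u v. rotate k cs = u @ v \<and> u \<noteq> [] \<and> length v \<ge> 3 \<and>
       (continuant u = 1 \<or> continuant u = -1)) \<longleftrightarrow> \<not> ?R" (is "?L \<longleftrightarrow> _")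
  proof
    assume ?L
    then obtain k u v where rot: "rotate k cs = u @ v" and u: "u \<noteq> []" and "length v \<ge> 3"
      and cont: "continuant u = 1 \<or> continuant u = -1"
      by blast
    moreover have "length cs = length u + length v"
      using arg_cong[OF rot, of length] by simp
    ultimately have "length u \<le> length cs - 3"
      by simp
    \<comment> \<open>Rotations depend only on k modulo n, which brings the start of the window into
      the range of the quantifier.\<close>
    then have "take (length cs - 3) (rotate (k mod length cs) cs)
        = u @ take (length cs - 3 - length u) v"
      using rot by (simp flip: rotate_conv_mod)
    then have "\<not> admissible (take (length cs - 3) (rotate (k mod length cs) cs))"
      using u cont by (auto simp: admissible_def)
    moreover have "k mod length cs < length cs"
      using len by (intro mod_less_divisor) linarith
    ultimately show "\<not> ?R"
      by blast
  next
    assume "\<not> ?R"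
    then obtain k u where "sublist u (take (length cs - 3) (rotate k cs))" and u: "u \<noteq> []"
      and cont: "continuant u = 1 \<or> continuant u = -1"
      by (auto simp: admissible_def)
    then obtain p s where split: "take (length cs - 3) (rotate k cs) = p @ u @ s"
      by (auto simp: sublist_def)
    \<comment> \<open>The three entries beyond the window; they make the complement of
      \<open>u\<close> long enough.\<close>
    define t where "t = drop (length cs - 3) (rotate k cs)"
    have rot: "rotate k cs = p @ u @ s @ t"
      using append_take_drop_id[of "length cs - 3" "rotate k cs"] by (simp add: split t_def)
    have "rotate (length p + k) cs = rotate (length p) (p @ u @ s @ t)"
      by (simp add: rot flip: rotate_rotate)
    also have "\<dots> = u @ (s @ t @ p)"
      by (simp add: rotate_append)
    finally have "rotate (length p + k) cs = u @ (s @ t @ p)" .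
    moreover have "length (s @ t @ p) \<ge> 3"
      using len by (simp add: t_def)
    ultimately show ?L
      using u cont by blast
  qed
  then show ?thesis
    using len by (auto simp only: irreducible_solution_def reducible_iff)
qed (simp add: irreducible_solution_def)

section \<open>Windows in solutions of size 3 to 6 and beyond\<close>

text \<open>A proper block misses the first or the last entry, so each length adds only the
  continuant of the whole word.\<close>

lemma admissible_simps:
  "admissible [a] \<longleftrightarrow> a \<noteq> 1 \<and> a \<noteq> -1"
  "admissible [a, b] \<longleftrightarrow> admissible [a] \<and> admissible [b] \<and> continuant [a, b] \<notin> {1, -1}"
  "admissible [a, b, c] \<longleftrightarrow> admissible [a, b] \<and> admissible [b, c] \<and> continuant [a, b, c] \<notin> {1, -1}"
  "admissible [a, b, c, d] \<longleftrightarrow> admissible [a, b, c] \<and> admissible [b, c, d]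
     \<and> continuant [a, b, c, d] \<notin> {1, -1}"
  by (simp_all add: admissible_def conj_ac del: continuant_simps(3) in_set_sublists)

lemma admissible_sublist: "admissible w \<Longrightarrow> sublist v w \<Longrightarrow> admissible v"
  by (auto simp: admissible_def dest: sublist_order.order.trans)

text \<open>The windows are empty in size 3, so every solution of that size is irreducible.\<close>

lemma irreducible_solution_3:
  "irreducible_solution [a, b, c] \<longleftrightarrow> (b = 1 \<or> b = -1) \<and> a = b \<and> c = b"
proof -
  have "solution [a, b, c] \<longleftrightarrow> (b = 1 \<or> b = -1) \<and> a = b \<and> c = b"
    using solution_Cons_snoc_iff[of "[b]" a c] by simp
  then show ?thesis
    by (simp add: irreducible_solution_iff admissible_def)
qed

text \<open>Windows are single entries here, pairs in size 5 and triples in size 6; the outer two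
  entries are always computed from the inner ones.\<close>

lemma irreducible_solution_4:
  "irreducible_solution [a, b, c, d] \<longleftrightarrow>
     (admissible [a] \<and> admissible [b] \<and> admissible [c] \<and> admissible [d]) \<and>
     (b * c - 1 = 1 \<or> b * c - 1 = -1) \<and> a = (b * c - 1) * c \<and> d = (b * c - 1) * b"
proof -
  have "(\<forall>k<length [a, b, c, d]. admissible (take (length [a, b, c, d] - 3) (rotate k [a, b, c, d])))
      \<longleftrightarrow> admissible [a] \<and> admissible [b] \<and> admissible [c] \<and> admissible [d]"
    by (simp add: All_less_Suc conj_ac)
  moreover have "solution [a, b, c, d] \<longleftrightarrow>
      (b * c - 1 = 1 \<or> b * c - 1 = -1) \<and> a = (b * c - 1) * c \<and> d = (b * c - 1) * b"
    using solution_Cons_snoc_iff[of "[b, c]" a d]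
    by (simp only: append.simps continuant_simps list.sel butlast.simps list.distinct if_False if_True)
      simp
  moreover have "3 \<le> length [a, b, c, d]"
    by simp
  ultimately show ?thesis
    unfolding irreducible_solution_iff by argo
qed

lemma irreducible_solution_5:
  "irreducible_solution [a, b, c, d, e] \<longleftrightarrow>
     (admissible [a, b] \<and> admissible [b, c] \<and> admissible [c, d] \<and> admissible [d, e]
       \<and> admissible [e, a]) \<and> (continuant [b, c, d] = 1 \<or> continuant [b, c, d] = -1)
     \<and> a = continuant [b, c, d] * continuant [c, d] \<and> e = continuant [b, c, d] * continuant [b, c]"
proof -
  have "(\<forall>k<length [a, b, c, d, e].
        admissible (take (length [a, b, c, d, e] - 3) (rotate k [a, b, c, d, e])))
      \<longleftrightarrow> admissible [a, b] \<and> admissible [b, c] \<and> admissible [c, d] \<and> admissible [d, e]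
        \<and> admissible [e, a]"
    by (simp add: All_less_Suc conj_ac)
  moreover have "solution [a, b, c, d, e] \<longleftrightarrow>
      (continuant [b, c, d] = 1 \<or> continuant [b, c, d] = -1)
      \<and> a = continuant [b, c, d] * continuant [c, d] \<and> e = continuant [b, c, d] * continuant [b, c]"
    using solution_Cons_snoc_iff[of "[b, c, d]" a e]
    by (simp only: append.simps list.sel butlast.simps list.distinct if_False if_True) simp
  moreover have "3 \<le> length [a, b, c, d, e]"
    by simp
  ultimately show ?thesis
    unfolding irreducible_solution_iff by argo
qed

lemma irreducible_solution_6:
  "irreducible_solution [a, b, c, d, e, f] \<longleftrightarrow>
     (admissible [a, b, c] \<and> admissible [b, c, d] \<and> admissible [c, d, e] \<and> admissible [d, e, f]
       \<and> admissible [e, f, a] \<and> admissible [f, a, b])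
     \<and> (continuant [b, c, d, e] = 1 \<or> continuant [b, c, d, e] = -1)
     \<and> a = continuant [b, c, d, e] * continuant [c, d, e]
     \<and> f = continuant [b, c, d, e] * continuant [b, c, d]"
proof -
  have "(\<forall>k<length [a, b, c, d, e, f].
        admissible (take (length [a, b, c, d, e, f] - 3) (rotate k [a, b, c, d, e, f])))
      \<longleftrightarrow> admissible [a, b, c] \<and> admissible [b, c, d] \<and> admissible [c, d, e] \<and> admissible [d, e, f]
        \<and> admissible [e, f, a] \<and> admissible [f, a, b]"
    by (simp add: All_less_Suc conj_ac)
  moreover have "solution [a, b, c, d, e, f] \<longleftrightarrow>
      (continuant [b, c, d, e] = 1 \<or> continuant [b, c, d, e] = -1)
      \<and> a = continuant [b, c, d, e] * continuant [c, d, e]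
      \<and> f = continuant [b, c, d, e] * continuant [b, c, d]"
    using solution_Cons_snoc_iff[of "[b, c, d, e]" a f]
    by (simp only: append.simps list.sel butlast.simps list.distinct if_False if_True) simp
  moreover have "3 \<le> length [a, b, c, d, e, f]"
    by simp
  ultimately show ?thesis
    unfolding irreducible_solution_iff by argo
qed

text \<open>From size 7 on, windows have at least four entries, and two consecutive ones give
  overlapping admissible words of length 4. Ruling these out excludes all large sizes by a finite
  check.\<close>

lemma irreducible_solution_long:
  fixes cs :: "'a::comm_ring_1 list"
  assumes "irreducible_solution cs" and "length cs \<ge> 7"
  obtains a b c d e :: 'a where "admissible [a, b, c, d]" "admissible [b, c, d, e]"
proof -
  from assms(2) obtain a b c d e f g r where cs: "cs = a # b # c # d # e # f # g # r"
    by (auto simp: numeral_eq_Suc Suc_le_length_iff)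
  have window: "admissible (take (length cs - 3) (rotate k cs))" if "k < length cs" for k
    using assms(1) that by (simp add: irreducible_solution_iff)
  show ?thesis
  proof (rule that[of a b c d e])
    have "admissible ([a, b, c, d] @ take (length r) (e # f # g # r))"
      using window[of 0] by (simp add: cs)
    then show "admissible [a, b, c, d]"
      by (rule admissible_sublist) simp
    have "admissible ([b, c, d, e] @ take (length r) (f # g # r @ [a]))"
      using window[of 1] by (simp add: cs)
    then show "admissible [b, c, d, e]"
      by (rule admissible_sublist) simp
  qed
qed

subsection \<open>Classification\<close>

lemma reducible_rotate: "reducible cs \<Longrightarrow> reducible (rotate j cs)"
proof -
  assume red: "reducible cs"
  then obtain k u v where rot: "rotate k cs = u @ v"
    and uv: "u \<noteq> []" "length v \<ge> 3" "continuant u = 1 \<or> continuant u = -1"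
    unfolding reducible_iff by blast
  obtain i where "rotate i (rotate j cs) = cs"
    by (rule rotate_inverse)
  then have "rotate (k + i) (rotate j cs) = u @ v"
    using rot by (simp flip: rotate_rotate)
  with red uv show ?thesis
    unfolding reducible_iff solution_rotate_iff by blast
qed

lemma irreducible_solution_rotate:
  assumes "irreducible_solution cs"
  shows "irreducible_solution (rotate j cs)"
proof -
  obtain i where "rotate i (rotate j cs) = cs"
    by (rule rotate_inverse)
  then show ?thesis
    using assms reducible_rotate[of "rotate j cs" i] by (auto simp: irreducible_solution_def)
qed

lemma irreducible_solution_cyclic_closure:
  "cs \<in> cyclic_closure S \<Longrightarrow> \<forall>as\<in>S. irreducible_solution as \<Longrightarrow> irreducible_solution cs"
  by (auto simp: cyclic_closure_def cyclic_perm_def intro: irreducible_solution_rotate)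

text \<open>Rotation counts matter only modulo the length, so the closure becomes an explicit finite
  set whose membership the simplifier decides.\<close>

lemma cyclic_closure_simps:
  "cyclic_closure {} = {}"
  "cyclic_closure (insert (a # as) S) =
     set (map (\<lambda>k. rotate k (a # as)) [0..<Suc (length as)]) \<union> cyclic_closure S"
proof -
  have "cyclic_perm cs (a # as) \<longleftrightarrow> (\<exists>k<Suc (length as). cs = rotate k (a # as))" for cs
    unfolding cyclic_perm_def
    by (metis length_Cons mod_less_divisor rotate_conv_mod zero_less_Suc)
  then show "cyclic_closure (insert (a # as) S) =
      set (map (\<lambda>k. rotate k (a # as)) [0..<Suc (length as)]) \<union> cyclic_closure S"
    by (auto simp: cyclic_closure_def image_iff simp del: upt_Suc)
qed (simp add: cyclic_closure_def)

text \<open>Prepares a finite search: the middle entries form a word with continuant p, restricted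
  by the windows inside it, and the outer entries are functions of them. The assumption
  \<open>short\<close> bounds the size by 6.\<close>

lemma irreducible_solution_cases:
  fixes cs :: "'a::comm_ring_1 list"
  assumes irr: "irreducible_solution cs"
    and short: "\<And>a b c d e :: 'a. \<not> (admissible [a, b, c, d] \<and> admissible [b, c, d, e])"
  obtains (3) p where "p = 1 \<or> p = -1" "cs = [p, p, p]"
  | (4) p b c where "p = 1 \<or> p = -1" "b * c - 1 = p" "admissible [b]" "admissible [c]"
      "cs = [p * c, b, c, p * b]"
  | (5) p b c d where "p = 1 \<or> p = -1" "continuant [b, c, d] = p"
      "admissible [b, c]" "admissible [c, d]"
      "cs = [p * continuant [c, d], b, c, d, p * continuant [b, c]]"
  | (6) p b c d e where "p = 1 \<or> p = -1" "continuant [b, c, d, e] = p"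
      "admissible [b, c, d]" "admissible [c, d, e]"
      "cs = [p * continuant [c, d, e], b, c, d, e, p * continuant [b, c, d]]"
proof -
  have "length cs < 7"
    using irr short irreducible_solution_long[of cs] by (metis not_le)
  moreover have "length cs \<ge> 3"
    using irr by (simp add: irreducible_solution_def)
  ultimately consider "length cs = 3" | "length cs = 4" | "length cs = 5" | "length cs = 6"
    by linarith
  then show ?thesis
  proof cases
    case 1
    then obtain a b c where cs: "cs = [a, b, c]"
      by (auto simp: numeral_eq_Suc length_Suc_conv)
    show ?thesis
      using irr that(1)[of b] unfolding cs irreducible_solution_3 by blast
  next
    case 2
    then obtain a b c d where cs: "cs = [a, b, c, d]"
      by (auto simp: numeral_eq_Suc length_Suc_conv)
    show ?thesis
      using irr that(2)[of "b * c - 1" b c] unfolding cs irreducible_solution_4 by blast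
  next
    case 3
    then obtain a b c d e where cs: "cs = [a, b, c, d, e]"
      by (auto simp: numeral_eq_Suc length_Suc_conv)
    show ?thesis
      using irr that(3)[of "continuant [b, c, d]" b c d] unfolding cs irreducible_solution_5 by blast
  next
    case 4
    then obtain a b c d e f where cs: "cs = [a, b, c, d, e, f]"
      by (auto simp: numeral_eq_Suc length_Suc_conv)
    show ?thesis
      using irr that(4)[of "continuant [b, c, d, e]" b c d e] unfolding cs irreducible_solution_6
      by blast
  qed
qed

section \<open>Admissible words modulo 2 to 6\<close>

lemma mod_2_exhaust: "x = 0 \<or> x = 1" for x :: 2
proof (cases x)
  case (of_int z)
  then have "z = 0 \<or> z = 1"
    by simp arith
  then show ?thesis
    using of_int by auto
qed

lemma admissible_1_mod_2: "admissible [a :: 2] \<longleftrightarrow> a = 0"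
  using mod_2_exhaust[of a] by (elim disjE; simp add: admissible_simps)

text \<open>The only admissible entry is 0, and \<open>continuant [0, 0] = -1\<close>. Thus sizes 5
  and above are impossible; the same happens modulo 3.\<close>

lemma admissible_2_mod_2: "admissible [a :: 2, b] \<longleftrightarrow> False"
  using mod_2_exhaust[of a] mod_2_exhaust[of b]
  by (elim disjE; simp add: admissible_simps(2) admissible_1_mod_2)

lemma mod_3_exhaust: "x = 0 \<or> x = 1 \<or> x = 2" for x :: 3
proof (cases x)
  case (of_int z)
  then have "z = 0 \<or> z = 1 \<or> z = 2"
    by simp arith
  then show ?thesis
    using of_int by auto
qed

lemma admissible_1_mod_3: "admissible [a :: 3] \<longleftrightarrow> a = 0"
  using mod_3_exhaust[of a] by (elim disjE; simp add: admissible_simps)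

lemma admissible_2_mod_3: "admissible [a :: 3, b] \<longleftrightarrow> False"
  using mod_3_exhaust[of a] mod_3_exhaust[of b]
  by (elim disjE; simp add: admissible_simps(2) admissible_1_mod_3)

lemma mod_4_exhaust: "x = 0 \<or> x = 1 \<or> x = 2 \<or> x = 3" for x :: 4
proof (cases x)
  case (of_int z)
  then have "z = 0 \<or> z = 1 \<or> z = 2 \<or> z = 3"
    by simp arith
  then show ?thesis
    using of_int by auto
qed

lemma admissible_1_mod_4: "admissible [a :: 4] \<longleftrightarrow> a = 0 \<or> a = 2"
  using mod_4_exhaust[of a] by (elim disjE; simp add: admissible_simps)

text \<open>Admissible entries are even, so two of them have product 0 and continuant -1.\<close>

lemma admissible_2_mod_4: "admissible [a :: 4, b] \<longleftrightarrow> False"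
  using mod_4_exhaust[of a] mod_4_exhaust[of b]
  by (elim disjE; simp add: admissible_simps(2) admissible_1_mod_4)

lemma mod_5_exhaust: "x = 0 \<or> x = 1 \<or> x = 2 \<or> x = 3 \<or> x = 4" for x :: 5
proof (cases x)
  case (of_int z)
  then have "z = 0 \<or> z = 1 \<or> z = 2 \<or> z = 3 \<or> z = 4"
    by simp arith
  then show ?thesis
    using of_int by auto
qed

lemma admissible_1_mod_5: "admissible [a :: 5] \<longleftrightarrow> a = 0 \<or> a = 2 \<or> a = 3"
  using mod_5_exhaust[of a] by (elim disjE; simp add: admissible_simps)

text \<open>Next to a 0 the continuant is -1; pairs from 2 and 3 have continuant 3 or 0.\<close>

lemma admissible_2_mod_5: "admissible [a :: 5, b] \<longleftrightarrow> (a = 2 \<or> a = 3) \<and> (b = 2 \<or> b = 3)"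
  using mod_5_exhaust[of a] mod_5_exhaust[of b]
  by (elim disjE; simp add: admissible_simps(2) admissible_1_mod_5)

text \<open>Among triples of 2s and 3s, exactly the constant ones have continuant 1 or -1.\<close>

lemma admissible_3_mod_5: "admissible [a :: 5, b, c] \<longleftrightarrow> (a = 2 \<or> a = 3) \<and> (b = 2 \<or> b = 3) \<and> (c = 2 \<or> c = 3)
    \<and> \<not> (a = b \<and> b = c)"
  using mod_5_exhaust[of a] mod_5_exhaust[of b] mod_5_exhaust[of c]
  by (elim disjE; simp add: admissible_simps(3) admissible_2_mod_5)

text \<open>The only admissible words of length 4 are 2, 2, 3, 3 and 3, 3, 2, 2. They exist, so one
  window would not give a contradiction, but neither can be followed by an admissible word shifted
  by one.\<close>

lemma not_admissible_mod_5: "\<not> (admissible [a :: 5, b, c, d] \<and> admissible [b, c, d, e])"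
proof
  assume adm: "admissible [a, b, c, d] \<and> admissible [b, c, d, e]"
  \<comment> \<open>These two triples already confine all five entries to 2 and 3, which leaves 32
    cases.\<close>
  then have "admissible [a, b, c]" "admissible [c, d, e]"
    by (simp_all only: admissible_simps(4))
  then have "a = 2 \<or> a = 3" "b = 2 \<or> b = 3" "c = 2 \<or> c = 3" "d = 2 \<or> d = 3" "e = 2 \<or> e = 3"
    by (simp_all only: admissible_3_mod_5)
  with adm show False
    by (elim disjE; simp add: admissible_simps(4) admissible_3_mod_5)
qed

lemma mod_6_exhaust: "x = 0 \<or> x = 1 \<or> x = 2 \<or> x = 3 \<or> x = 4 \<or> x = 5" for x :: 6
proof (cases x)
  case (of_int z)
  then have "z = 0 \<or> z = 1 \<or> z = 2 \<or> z = 3 \<or> z = 4 \<or> z = 5"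
    by simp arith
  then show ?thesis
    using of_int by auto
qed

lemma admissible_1_mod_6: "admissible [a :: 6] \<longleftrightarrow> a = 0 \<or> a = 2 \<or> a = 3 \<or> a = 4"
  using mod_6_exhaust[of a] by (elim disjE; simp add: admissible_simps)

text \<open>A 0 gives continuant -1, and distinct entries among 2, 3, 4 give 1 or -1, so admissible
  words of length at least 2 are constant.\<close>

lemma admissible_2_mod_6: "admissible [a :: 6, b] \<longleftrightarrow> (a = 2 \<or> a = 3 \<or> a = 4) \<and> b = a"
  using mod_6_exhaust[of a] mod_6_exhaust[of b]
  by (elim disjE; simp add: admissible_simps(2) admissible_1_mod_6)

lemma admissible_3_mod_6:
  "admissible [a :: 6, b, c] \<longleftrightarrow> (a = 2 \<or> a = 3 \<or> a = 4) \<and> b = a \<and> c = a"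
proof (cases "(a = 2 \<or> a = 3 \<or> a = 4) \<and> b = a \<and> c = a")
  case True
  then have "a = 2 \<or> a = 3 \<or> a = 4" "b = a" "c = a"
    by blast+
  then show ?thesis
    by (elim disjE; simp add: admissible_simps(3) admissible_2_mod_6)
next
  case False
  then show ?thesis
    unfolding admissible_simps(3) admissible_2_mod_6 by blast
qed

text \<open>The constant words of 2s, 3s and 4s of length 4 have continuants -1, 1 and -1.\<close>

lemma not_admissible_mod_6: "\<not> admissible [a :: 6, b, c, d]"
proof
  assume adm: "admissible [a, b, c, d]"
  then have "a = 2 \<or> a = 3 \<or> a = 4" "b = a" "c = a" "d = b"
    by (simp_all only: admissible_simps(4) admissible_3_mod_6)
  with adm show False
    by (elim disjE; simp add: admissible_simps(4))
qed

section \<open>The classification for each modulus\<close>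

lemma irreducible_solution_mod_2:
  "{cs :: 2 list. irreducible_solution cs} =
       cyclic_closure {[1, 1, 1], [0, 0, 0, 0]}"
  (is "_ = cyclic_closure ?S")
proof (intro set_eqI iffI; unfold mem_Collect_eq)
  fix cs :: "2 list"
  assume "irreducible_solution cs"
  moreover have "\<not> (admissible [a :: 2, b, c, d] \<and> admissible [b, c, d, e])" for a b c d e
    by (simp add: admissible_simps(3,4) admissible_2_mod_2)
  ultimately show "cs \<in> cyclic_closure ?S"
  proof (cases rule: irreducible_solution_cases)
    case (3 p)
    \<comment> \<open>Modulo 2 both signs p are equal to 1, so only one triple arises.\<close>
    then show ?thesis
      by (elim disjE; simp add: cyclic_closure_simps)
  next
    case (4 p b c)
    then have "b = 0" "c = 0"
      by (simp_all only: admissible_1_mod_2)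
    with 4 show ?thesis
      by (elim disjE; simp add: cyclic_closure_simps)
  next
    case (5 p b c d)
    then show ?thesis
      by (simp only: admissible_2_mod_2)
  next
    case (6 p b c d e)
    then show ?thesis
      unfolding admissible_simps(3) admissible_2_mod_2 by blast
  qed
next
  fix cs :: "2 list"
  assume "cs \<in> cyclic_closure ?S"
  moreover have "\<forall>as\<in>?S. irreducible_solution as"
    by (simp add: irreducible_solution_3 irreducible_solution_4
        admissible_1_mod_2)
  ultimately show "irreducible_solution cs"
    by (rule irreducible_solution_cyclic_closure)
qed

lemma irreducible_solution_mod_3:
  "{cs :: 3 list. irreducible_solution cs} =
       cyclic_closure {[1, 1, 1], [- 1, - 1, - 1], [0, 0, 0, 0]}"
  (is "_ = cyclic_closure ?S")
proof (intro set_eqI iffI; unfold mem_Collect_eq)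
  fix cs :: "3 list"
  assume "irreducible_solution cs"
  moreover have "\<not> (admissible [a :: 3, b, c, d] \<and> admissible [b, c, d, e])" for a b c d e
    by (simp add: admissible_simps(3,4) admissible_2_mod_3)
  ultimately show "cs \<in> cyclic_closure ?S"
  proof (cases rule: irreducible_solution_cases)
    case (3 p)
    then show ?thesis
      by (elim disjE; simp add: cyclic_closure_simps)
  next
    case (4 p b c)
    then have "b = 0" "c = 0"
      by (simp_all only: admissible_1_mod_3)
    with 4 show ?thesis
      by (elim disjE; simp add: cyclic_closure_simps)
  next
    case (5 p b c d)
    then show ?thesis
      by (simp only: admissible_2_mod_3)
  next
    case (6 p b c d e)
    then show ?thesis
      unfolding admissible_simps(3) admissible_2_mod_3 by blast
  qed
next
  fix cs :: "3 list"
  assume "cs \<in> cyclic_closure ?S"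
  moreover have "\<forall>as\<in>?S. irreducible_solution as"
    by (simp add: irreducible_solution_3 irreducible_solution_4
        admissible_1_mod_3)
  ultimately show "irreducible_solution cs"
    by (rule irreducible_solution_cyclic_closure)
qed

lemma irreducible_solution_mod_4:
  "{cs :: 4 list. irreducible_solution cs} =
       cyclic_closure {[1, 1, 1], [- 1, - 1, - 1], [0, 0, 0, 0], [0, 2, 0, 2], [2, 0, 2, 0],
         [2, 2, 2, 2]}"
  (is "_ = cyclic_closure ?S")
proof (intro set_eqI iffI; unfold mem_Collect_eq)
  fix cs :: "4 list"
  assume "irreducible_solution cs"
  moreover have "\<not> (admissible [a :: 4, b, c, d] \<and> admissible [b, c, d, e])" for a b c d e
    by (simp add: admissible_simps(3,4) admissible_2_mod_4)
  ultimately show "cs \<in> cyclic_closure ?S"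
  proof (cases rule: irreducible_solution_cases)
    case (3 p)
    then show ?thesis
      by (elim disjE; simp add: cyclic_closure_simps)
  next
    case (4 p b c)
    then have "b = 0 \<or> b = 2" "c = 0 \<or> c = 2"
      by (simp_all only: admissible_1_mod_4)
    with 4 show ?thesis
      by (elim disjE; simp add: cyclic_closure_simps)
  next
    case (5 p b c d)
    then show ?thesis
      by (simp only: admissible_2_mod_4)
  next
    case (6 p b c d e)
    then show ?thesis
      unfolding admissible_simps(3) admissible_2_mod_4 by blast
  qed
next
  fix cs :: "4 list"
  assume "cs \<in> cyclic_closure ?S"
  moreover have "\<forall>as\<in>?S. irreducible_solution as"
    by (simp add: irreducible_solution_3 irreducible_solution_4
        admissible_1_mod_4)
  ultimately show "irreducible_solution cs"
    by (rule irreducible_solution_cyclic_closure)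
qed

lemma irreducible_solution_mod_5:
  "{cs :: 5 list. irreducible_solution cs} =
       cyclic_closure {[1, 1, 1], [- 1, - 1, - 1], [0, 0, 0, 0], [0, 2, 0, 3],
         [2, 2, 2, 2, 2], [3, 3, 3, 3, 3],
         [3, 2, 2, 3, 2, 2], [2, 3, 3, 2, 3, 3], [2, 3, 2, 3, 2, 3]}"
  (is "_ = cyclic_closure ?S")
proof (intro set_eqI iffI; unfold mem_Collect_eq)
  fix cs :: "5 list"
  assume "irreducible_solution cs"
  moreover have "\<not> (admissible [a :: 5, b, c, d] \<and> admissible [b, c, d, e])" for a b c d e
    by (rule not_admissible_mod_5)
  ultimately show "cs \<in> cyclic_closure ?S"
  proof (cases rule: irreducible_solution_cases)
    case (3 p)
    then show ?thesis
      by (elim disjE; simp add: cyclic_closure_simps)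
  next
    case (4 p b c)
    then have "b = 0 \<or> b = 2 \<or> b = 3" "c = 0 \<or> c = 2 \<or> c = 3"
      by (simp_all only: admissible_1_mod_5)
    with 4 show ?thesis
      by (elim disjE; simp add: cyclic_closure_simps)
  next
    case (5 p b c d)
    \<comment> \<open>Of these eight triples only the constant ones have continuant 1 or -1; they
      give the constant solutions of size 5.\<close>
    then have "b = 2 \<or> b = 3" "c = 2 \<or> c = 3" "d = 2 \<or> d = 3"
      by (simp_all only: admissible_2_mod_5)
    with 5 show ?thesis
      by (elim disjE; simp add: cyclic_closure_simps)
  next
    case (6 p b c d e)
    then have "b = 2 \<or> b = 3" "c = 2 \<or> c = 3" "d = 2 \<or> d = 3" "e = 2 \<or> e = 3"
      by (simp_all only: admissible_3_mod_5)
    \<comment> \<open>Here \<open>admissible_3_mod_5\<close> discards words with three equal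
      consecutive entries; 2, 2, 3, 3 and its reverse drop out because their continuant is
      3.\<close>
    with 6 show ?thesis
      by (elim disjE; simp add: cyclic_closure_simps admissible_3_mod_5)
  qed
next
  fix cs :: "5 list"
  assume "cs \<in> cyclic_closure ?S"
  moreover have "\<forall>as\<in>?S. irreducible_solution as"
    by (simp add: irreducible_solution_3 irreducible_solution_4
        irreducible_solution_5 irreducible_solution_6
        admissible_1_mod_5 admissible_2_mod_5 admissible_3_mod_5)
  ultimately show "irreducible_solution cs"
    by (rule irreducible_solution_cyclic_closure)
qed

lemma irreducible_solution_mod_6:
  "{cs :: 6 list. irreducible_solution cs} =
       cyclic_closure {[1, 1, 1], [- 1, - 1, - 1], [0, 0, 0, 0], [2, 4, 2, 4], [2, 3, 4, 3],
         [0, 2, 0, 4], [0, 3, 0, 3],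
         [2, 2, 2, 2, 2, 2], [3, 3, 3, 3, 3, 3], [4, 4, 4, 4, 4, 4]}"
  (is "_ = cyclic_closure ?S")
proof (intro set_eqI iffI; unfold mem_Collect_eq)
  fix cs :: "6 list"
  assume "irreducible_solution cs"
  moreover have "\<not> (admissible [a :: 6, b, c, d] \<and> admissible [b, c, d, e])" for a b c d e
    by (simp add: not_admissible_mod_6)
  ultimately show "cs \<in> cyclic_closure ?S"
  proof (cases rule: irreducible_solution_cases)
    case (3 p)
    then show ?thesis
      by (elim disjE; simp add: cyclic_closure_simps)
  next
    case (4 p b c)
    then have "b = 0 \<or> b = 2 \<or> b = 3 \<or> b = 4" "c = 0 \<or> c = 2 \<or> c = 3 \<or> c = 4"
      by (simp_all only: admissible_1_mod_6)
    with 4 show ?thesis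
      by (elim disjE; simp add: cyclic_closure_simps)
  next
    case (5 p b c d)
    then have "b = 2 \<or> b = 3 \<or> b = 4" "c = b" "d = b"
      by (simp_all only: admissible_2_mod_6)
    \<comment> \<open>No solution of size 5 arises: the constant triples of 2s, 3s and 4s have
      continuants 4, 3 and 2.\<close>
    with 5 show ?thesis
      by (elim disjE; simp add: cyclic_closure_simps)
  next
    case (6 p b c d e)
    then have "b = 2 \<or> b = 3 \<or> b = 4" "c = b" "d = b" "e = b"
      by (simp_all only: admissible_3_mod_6)
    with 6 show ?thesis
      by (elim disjE; simp add: cyclic_closure_simps admissible_3_mod_6)
  qed
next
  fix cs :: "6 list"
  assume "cs \<in> cyclic_closure ?S"
  moreover have "\<forall>as\<in>?S. irreducible_solution as"
    by (simp add: irreducible_solution_3 irreducible_solution_4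
        irreducible_solution_5 irreducible_solution_6
        admissible_1_mod_6 admissible_2_mod_6 admissible_3_mod_6)
  ultimately show "irreducible_solution cs"
    by (rule irreducible_solution_cyclic_closure)
qed

theorem theorem2p5:
  shows
  "{cs :: 2 list. irreducible_solution cs} =
       cyclic_closure {[1, 1, 1], [0, 0, 0, 0]} \<and>
   {cs :: 3 list. irreducible_solution cs} =
       cyclic_closure {[1, 1, 1], [- 1, - 1, - 1], [0, 0, 0, 0]} \<and>
   {cs :: 4 list. irreducible_solution cs} =
       cyclic_closure {[1, 1, 1], [- 1, - 1, - 1], [0, 0, 0, 0], [0, 2, 0, 2], [2, 0, 2, 0],
         [2, 2, 2, 2]} \<and>
   {cs :: 5 list. irreducible_solution cs} =
       cyclic_closure {[1, 1, 1], [- 1, - 1, - 1], [0, 0, 0, 0], [0, 2, 0, 3],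
         [2, 2, 2, 2, 2], [3, 3, 3, 3, 3],
         [3, 2, 2, 3, 2, 2], [2, 3, 3, 2, 3, 3], [2, 3, 2, 3, 2, 3]} \<and>
   {cs :: 6 list. irreducible_solution cs} =
       cyclic_closure {[1, 1, 1], [- 1, - 1, - 1], [0, 0, 0, 0], [2, 4, 2, 4], [2, 3, 4, 3],
         [0, 2, 0, 4], [0, 3, 0, 3],
         [2, 2, 2, 2, 2, 2], [3, 3, 3, 3, 3, 3], [4, 4, 4, 4, 4, 4]}"
  by (intro conjI irreducible_solution_mod_2 irreducible_solution_mod_3 irreducible_solution_mod_4
      irreducible_solution_mod_5 irreducible_solution_mod_6)

end
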